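(* Let $k,L\geq 1$ be integers. Let $\beta=\beta_0,\beta_1,\ldots,\beta_L\in\mathbb{C}$ satisfy $\beta_r-\beta_{r-1}\in\mathbb{C}\setminus\mathbb{Z}_{\leq 0}$ for $r=1,\ldots,L$. Let $\alpha\in\mathbb{C}$, $\gamma\in\mathbb{C}\setminus\mathbb{Z}_{\leq0}$, $\bm{\sigma}^{(1)},\ldots,\bm{\sigma}^{(L)}\in\mathbb{C}^{k}$, and $\mathbf{x},\mathbf{y}\in\mathbb{C}^k$ with $x_j\neq0$ for all $j$ and $|x_1|+\cdots+|x_k|<1$. Write $N:=\langle\mathbf{n}^{(1)}\rangle+\cdots+\langle\mathbf{n}^{(L)}\rangle$ for $\mathbf{n}^{(1)},\ldots,\mathbf{n}^{(L)}\in\mathbb{Z}_{\ge0}^k$. Then $$\Phi_1\left[\alpha,\beta;\gamma;\langle\mathbf{x}\rangle,\langle\mathbf{y}\rangle\right]=\sum_{\mathbf{n}^{(1)},\ldots,\mathbf{n}^{(L)}=\mathbf{0}}^{\infty}\frac{(\alpha)_{N}}{(\gamma)_{N}}(-\mathbf{x})^{\mathbf{n}^{(1)}+\cdots+\mathbf{n}^{(L)}}\left[\prod_{r=1}^{L}L_{\mathbf{n}^{(r)}}^{(\beta_r-\beta_{r-1}-\langle\mathbf{n}^{(r)}\rangle)}\left((\mathbf{1}-\bm{\sigma}^{(r)})\circ\bm{\sigma}^{(1)}\circ\cdots\circ\bm{\sigma}^{(r-1)}\circ\mathbf{y}/\mathbf{x}\right)\right]$$ $$\cdot\,\Phi_1\left[\alpha+N,\beta_L;\gamma+N;\langle\mathbf{x}\rangle,\langle\bm{\sigma}^{(L)}\circ\cdots\circ\bm{\sigma}^{(1)}\circ\mathbf{y}\rangle\right],$$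 where for $r=1$ the product $\bm{\sigma}^{(1)}\circ\cdots\circ\bm{\sigma}^{(r-1)}$ is absent.
   Context: Boldface letters denote vectors of dimension $k$. For $\mathbf{x},\mathbf{y}\in\mathbb{C}^k$ and $\mathbf{n}\in\mathbb{Z}_{\geq0}^k$: $\langle\mathbf{x}\rangle:=x_1+\cdots+x_k$, $\mathbf{x}\circ\mathbf{y}:=(x_1y_1,\ldots,x_ky_k)$, $\mathbf{x}/\mathbf{y}:=(x_1/y_1,\ldots,x_k/y_k)$, $\mathbf{x}^{\mathbf{n}}:=x_1^{n_1}\cdots x_k^{n_k}$, $\mathbf{1}=(1,\ldots,1)$; sums from $\mathbf{0}$ to $\infty$ run over all vectors in $\mathbb{Z}_{\ge0}^k$. $(a)_n=a(a+1)\cdots(a+n-1)$, $(a)_0=1$, is the Pochhammer symbol. Powers are principal branches. For every $\alpha\in\mathbb{C}$, Erdélyi's multivariate Laguerre polynomials $L_{\mathbf{n}}^{(\alpha)}(\mathbf{x})=L_{n_1,\ldots,n_k}^{(\alpha)}(x_1,\ldots,x_k)$ are defined by $$(1-\langle\mathbf{z}\rangle)^{-\alpha-1}\exp\left\{-\frac{\langle\mathbf{x}\circ\mathbf{z}\rangle}{1-\langle\mathbf{z}\rangle}\right\}=\sum_{\mathbf{n}=\mathbf{0}}^{\infty}L_{\mathbf{n}}^{(\alpha)}(\mathbf{x})\,\mathbf{z}^{\mathbf{n}},\qquad |z_1|+\cdots+|z_k|<1.$$ Humbert's function: $\Phi_1[a,b;c;x,y]:=\sum_{m,n=0}^{\infty}\frac{(a)_{m+n}(b)_m}{(c)_{m+n}}\frac{x^m}{m!}\frac{y^n}{n!}$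 for $|x|<1$, $|y|<\infty$, $c\notin\mathbb{Z}_{\le0}$. *)

theory Defs
  imports "HOL-Analysis.Analysis" "HOL-Library.Nonpos_Ints"
begin

text \<open>
  Vectors of dimension \<open>k\<close> are elements of \<open>'a ^ 'k\<close>. The componentwise product of the
  paper is the ring multiplication \<open>*\<close> of \<open>'a ^ 'k\<close>, and its all-ones vector is \<open>1\<close>.
\<close>

definition vsum :: "'a::comm_monoid_add ^ 'k \<Rightarrow> 'a"
  where "vsum x = (\<Sum>i\<in>UNIV. x $ i)"

definition vdiv :: "complex ^ 'k \<Rightarrow> complex ^ 'k \<Rightarrow> complex ^ 'k"
  where "vdiv x y = (\<chi> i. x $ i / y $ i)"

definition vpow :: "complex ^ 'k \<Rightarrow> nat ^ 'k \<Rightarrow> complex"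
  where "vpow x n = (\<Prod>i\<in>UNIV. (x $ i) ^ (n $ i))"

text \<open>
  Erdelyi's multivariate Laguerre polynomials are the coefficients of their generating function.
  This function is holomorphic on the complete Reinhardt domain \<open>|z\<^sub>1| + \<dots> + |z\<^sub>k| < 1\<close>
  (where \<open>1 - (z\<^sub>1 + \<dots> + z\<^sub>k)\<close> has positive real part, so that the principal branch is
  holomorphic), hence it has exactly one family of power series coefficients there.
\<close>

definition laguerre :: "complex \<Rightarrow> nat ^ 'k \<Rightarrow> complex ^ 'k \<Rightarrow> complex"
  where "laguerre \<alpha> n x =
    (THE l. \<forall>z. (\<Sum>i\<in>UNIV. norm (z $ i)) < 1 \<longrightarrow>
       ((\<lambda>m. l m * vpow z m) has_sum
          ((1 - vsum z) powr (- \<alpha> - 1) * exp (- (vsum (x * z) / (1 - vsum z))))) UNIV) n"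

text \<open>
  Humbert's function. It is meaningful for \<open>|x| < 1\<close>, arbitrary \<open>y\<close> and \<open>c\<close> not a
  nonpositive integer, where the double series converges absolutely.
\<close>

definition humbert_Phi1 :: "complex \<Rightarrow> complex \<Rightarrow> complex \<Rightarrow> complex \<Rightarrow> complex \<Rightarrow> complex"
  where "humbert_Phi1 a b c x y =
    (\<Sum>\<^sub>\<infinity>(m, n)\<in>UNIV. pochhammer a (m + n) * pochhammer b m / pochhammer c (m + n)
        * (x ^ m / fact m) * (y ^ n / fact n))"

end

theory Submission
  imports Defs "HOL-Complex_Analysis.Cauchy_Integral_Formula"
begin

text \<open>
  Up to the weights \<open>c j = pochhammer \<alpha> j / pochhammer \<gamma> j\<close>, Humbert's function \<open>\<Phi>\<^sub>1[\<alpha>, \<beta>; \<gamma>; X, Y]\<close> is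
  the product of a binomial and an exponential series: it is obtained from the power series of
  \<open>(1 - t X) powr (- \<beta>) * exp (t Y)\<close> by multiplying the coefficient of \<open>t ^ j\<close> with \<open>c j\<close> and setting
  \<open>t = 1\<close>. With \<open>N\<close> as in the theorem, \<open>c N\<close> times the weights of the function \<open>\<Phi>\<^sub>1\<close> with \<open>\<alpha>\<close> and \<open>\<gamma>\<close>
  shifted by \<open>N\<close> is again a weight \<open>c (N + m + p)\<close>. The right-hand side is therefore obtained in
  the same way from a product of generating functions, and it suffices that the generating functions
  of both sides agree; this is \<open>graded_weighted_sum_eq\<close>.

  The generating function of the \<open>r\<close>-th Laguerre factor is
  \<open>(1 - t X) powr (\<beta> r - \<beta> (r - 1)) * exp (t W\<^sub>r)\<close> with \<open>X = vsum x\<close> and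
  \<open>W\<^sub>r = vsum ((1 - \<sigma> r) * \<sigma> 1 * \<dots> * \<sigma> (r - 1) * y)\<close>; this is \<open>twisted_laguerre_has_sum\<close>. The last
  factor contributes \<open>(1 - t X) powr (- \<beta> L) * exp (t Y)\<close> with \<open>Y = vsum (\<sigma> 1 * \<dots> * \<sigma> L * y)\<close>. In the
  product both the exponents of \<open>1 - t X\<close> and the arguments of the exponential telescope, to \<open>- \<beta> 0\<close>
  and \<open>t * vsum y\<close>.

  The Laguerre factors are accessible through the closed form \<open>laguerre_eq\<close>, which rests on an
  expansion of the generating function that defines them (\<open>laguerre_term_has_sum\<close>) and on the
  uniqueness of power series coefficients in several variables (\<open>power_series_coeff_zero\<close>).
  There is room for the weights: \<open>c j\<close> is bounded by a multiple of \<open>s ^ j\<close> for every \<open>s > 1\<close>, and all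
  generating functions converge absolutely for \<open>norm t \<le> s\<close> if \<open>s\<close> is close enough to \<open>1\<close>.
\<close>

section \<open>Regrouping of sums, and families graded by a degree\<close>

lemma summable_on_complex_comparison:
  fixes f :: "'a \<Rightarrow> complex" and g :: "'a \<Rightarrow> 'b::banach"
  assumes "(\<lambda>i. norm (g i)) summable_on A" "\<And>i. i \<in> A \<Longrightarrow> norm (f i) \<le> norm (g i)"
  shows "f summable_on A"
  using Infinite_Sum.abs_summable_on_comparison_test[OF assms] summable_on_iff_abs_summable_on_complex
  by blast

lemma has_sum_times:
  fixes f :: "'a \<Rightarrow> complex" and g :: "'b \<Rightarrow> complex"
  assumes f: "(f has_sum S) A" and g: "(g has_sum T) B"
  shows "((\<lambda>(i, j). f i * g j) has_sum S * T) (A \<times> B)"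
proof (rule has_sum_SigmaI)
  show "((\<lambda>j. case (i, j) of (i, j) \<Rightarrow> f i * g j) has_sum f i * T) B" for i
    using has_sum_cmult_right[OF g] by simp
  show "((\<lambda>i. f i * T) has_sum S * T) A"
    by (rule has_sum_cmult_left[OF f])
  have "(\<lambda>i. norm (f i)) summable_on A" "(\<lambda>j. norm (g j)) summable_on B"
    using f g has_sum_imp_summable summable_on_iff_abs_summable_on_complex by blast+
  then have "(\<lambda>p. norm (case p of (i, j) \<Rightarrow> f i * g j)) summable_on A \<times> B"
    by (auto simp: Infinite_Sum.abs_summable_on_Sigma_iff norm_mult infsum_cmult_right' abs_mult
             intro!: summable_on_cmult_right summable_on_cmult_left)
  then show "(\<lambda>(i, j). f i * g j) summable_on A \<times> B"
    using summable_on_iff_abs_summable_on_complex by blast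
qed

lemma has_sum_prod_PiE:
  fixes f :: "'a \<Rightarrow> 'b \<Rightarrow> complex"
  assumes "finite A" "\<And>r. r \<in> A \<Longrightarrow> (f r has_sum S r) (B r)"
  shows "((\<lambda>g. \<Prod>r\<in>A. f r (g r)) has_sum (\<Prod>r\<in>A. S r)) (PiE A B)"
  using assms
proof (induction A rule: finite_induct)
  case empty
  show ?case using has_sum_finite[of "{\<lambda>_. undefined}" "\<lambda>_. 1::complex"] by simp
next
  case (insert a A)
  let ?h = "\<lambda>(y, g). g(a := y)"
  have inj: "inj_on ?h (B a \<times> PiE A B)"
    using insert.hyps(2) by (rule inj_combinator)
  have "((\<lambda>(y, g). f a y * (\<Prod>r\<in>A. f r (g r))) has_sum S a * (\<Prod>r\<in>A. S r)) (B a \<times> PiE A B)"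
    using insert by (intro has_sum_times) auto
  also have "?this \<longleftrightarrow>
     ((\<lambda>g. \<Prod>r\<in>insert a A. f r (g r)) \<circ> ?h has_sum S a * (\<Prod>r\<in>A. S r)) (B a \<times> PiE A B)"
    using insert.hyps by (intro has_sum_cong) (auto intro!: prod.cong)
  also have "\<dots> \<longleftrightarrow> ((\<lambda>g. \<Prod>r\<in>insert a A. f r (g r)) has_sum S a * (\<Prod>r\<in>A. S r)) (PiE (insert a A) B)"
    unfolding PiE_insert_eq by (rule has_sum_reindex[OF inj, symmetric])
  finally show ?case using insert.hyps by simp
qed

text \<open>
  Sums are regrouped along a function \<open>g\<close> throughout: along the degree of a term, and along the
  sum of two exponent vectors when power series are multiplied.
\<close>

lemma has_sum_fibres:
  fixes f :: "'a \<Rightarrow> complex"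
  assumes "(f has_sum S) A"
  shows "((\<lambda>b. \<Sum>\<^sub>\<infinity>a\<in>{a\<in>A. g a = b}. f a) has_sum S) UNIV"
proof (rule has_sum_Sigma')
  show "((\<lambda>(b, a). f a) has_sum S) (Sigma UNIV (\<lambda>b. {a\<in>A. g a = b}))"
    using assms
    by (subst has_sum_reindex_bij_witness[where i = "\<lambda>a. (g a, a)" and j = snd and T = A and h = f])
       auto
  show "((\<lambda>a. case (b, a) of (b, a) \<Rightarrow> f a) has_sum (\<Sum>\<^sub>\<infinity>a\<in>{a\<in>A. g a = b}. f a)) {a\<in>A. g a = b}" for b
    using summable_on_subset_banach[OF has_sum_imp_summable[OF assms], of "{a\<in>A. g a = b}"]
    by (auto simp: has_sum_infsum)
qed

text \<open>
  The sums over the terms of degree \<open>j\<close> are the coefficients of a power series in \<open>t\<close>, and a power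
  series determines its coefficients. This compares sums over index sets of completely different
  shape through their generating functions alone.
\<close>

lemma graded_fibre_sums_eq:
  fixes u :: "'a \<Rightarrow> complex" and v :: "'b \<Rightarrow> complex"
  assumes u: "\<And>t. norm t \<le> 1 \<Longrightarrow> ((\<lambda>i. u i * t ^ d i) has_sum F t) A"
    and v: "\<And>t. norm t \<le> 1 \<Longrightarrow> ((\<lambda>i. v i * t ^ e i) has_sum F t) B"
  shows "(\<Sum>\<^sub>\<infinity>i\<in>{i\<in>A. d i = j}. u i) = (\<Sum>\<^sub>\<infinity>i\<in>{i\<in>B. e i = j}. v i)"
proof -
  define a where "a j = (\<Sum>\<^sub>\<infinity>i\<in>{i\<in>A. d i = j}. u i)" for j
  define b where "b j = (\<Sum>\<^sub>\<infinity>i\<in>{i\<in>B. e i = j}. v i)" for j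
  have *: "((\<lambda>j. (\<Sum>\<^sub>\<infinity>i\<in>{i\<in>C. h i = j}. w i) * t ^ j) has_sum F t) UNIV"
    if "((\<lambda>i. w i * t ^ h i) has_sum F t) C" for t and w :: "'c \<Rightarrow> complex" and h C
  proof -
    have "(\<Sum>\<^sub>\<infinity>i\<in>{i\<in>C. h i = j}. w i * t ^ h i) = (\<Sum>\<^sub>\<infinity>i\<in>{i\<in>C. h i = j}. w i) * t ^ j" for j
      unfolding infsum_cmult_left'[symmetric] by (rule infsum_cong) auto
    then show ?thesis using has_sum_fibres[OF that, of h] by simp
  qed
  have diff: "((\<lambda>j. a j * t ^ j + - (b j * t ^ j)) has_sum F t + - F t) UNIV" if "norm t \<le> 1" for t
    unfolding a_def b_def
    by (intro has_sum_add has_sum_uminusI * u v that)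
  have sums: "(\<lambda>j. (a j - b j) * (t - 0) ^ j) sums 0" if "norm (t - 0) < 1" for t
    using has_sum_imp_sums[OF diff[of t]] that by (simp add: algebra_simps)
  have "(\<lambda>j. if j = 0 then a j - b j else 0) sums 0"
    using sums[of 0] by (simp add: power_0_left if_distrib cong: if_cong)
  then have "a 0 - b 0 = 0"
    using sums_If_finite_set[of "{0::nat}" "\<lambda>j. a j - b j"] by (auto dest: sums_unique2)
  moreover have "a j - b j = 0" if "j > 0"
  proof (rule ccontr)
    assume "a j - b j \<noteq> 0"
    from powser_0_nonzero[of 1 0 "\<lambda>j. a j - b j" "\<lambda>_. 0", OF _ sums _ this that]
    obtain s where s: "0 < s" "\<And>z::complex. z \<in> cball 0 s - {0} \<Longrightarrow> (0::complex) \<noteq> 0"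
      by auto
    from s(2)[of "of_real s"] s(1) show False by auto
  qed
  ultimately show ?thesis
    unfolding a_def b_def by (metis eq_iff_diff_eq_0 gr0I)
qed

text \<open>
  Attaching to each term a weight that depends only on its degree \<open>j\<close> multiplies the \<open>j\<close>-th
  coefficient by \<open>c j\<close> on both sides, so the weighted sums agree too. Because \<open>c\<close> is bounded,
  convergence at \<open>t = 1\<close> gives convergence of both weighted families.
\<close>

lemma graded_weighted_sum_eq:
  fixes u :: "'a \<Rightarrow> complex" and v :: "'b \<Rightarrow> complex"
  assumes u: "\<And>t. norm t \<le> 1 \<Longrightarrow> ((\<lambda>i. u i * t ^ d i) has_sum F t) A"
    and v: "\<And>t. norm t \<le> 1 \<Longrightarrow> ((\<lambda>i. v i * t ^ e i) has_sum F t) B"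
    and c: "\<And>j. norm (c j) \<le> C"
  shows "((\<lambda>i. c (d i) * u i) has_sum (\<Sum>\<^sub>\<infinity>i\<in>B. c (e i) * v i)) A"
proof -
  have "C \<ge> 0" using c norm_ge_zero order_trans by blast
  have *: "((\<lambda>j. c j * (\<Sum>\<^sub>\<infinity>i\<in>{i\<in>D. h i = j}. w i)) has_sum (\<Sum>\<^sub>\<infinity>i\<in>D. c (h i) * w i)) UNIV"
       "(\<lambda>i. c (h i) * w i) summable_on D"
    if "\<And>t. norm t \<le> 1 \<Longrightarrow> ((\<lambda>i. w i * t ^ h i) has_sum F t) D" for w :: "'c \<Rightarrow> complex" and h D
  proof -
    have "(\<lambda>i. norm (w i)) summable_on D"
      using that[of 1] has_sum_imp_summable summable_on_iff_abs_summable_on_complex by fastforce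
    then have "(\<lambda>i. norm (C * norm (w i))) summable_on D"
      using \<open>C \<ge> 0\<close> by (simp add: abs_mult summable_on_cmult_right)
    then show sm: "(\<lambda>i. c (h i) * w i) summable_on D"
      by (rule summable_on_complex_comparison)
         (use c \<open>C \<ge> 0\<close> in \<open>auto simp: norm_mult abs_mult intro!: mult_right_mono\<close>)
    have "(\<Sum>\<^sub>\<infinity>i\<in>{i\<in>D. h i = j}. c (h i) * w i) = c j * (\<Sum>\<^sub>\<infinity>i\<in>{i\<in>D. h i = j}. w i)" for j
      unfolding infsum_cmult_right'[symmetric] by (rule infsum_cong) auto
    then show "((\<lambda>j. c j * (\<Sum>\<^sub>\<infinity>i\<in>{i\<in>D. h i = j}. w i)) has_sum (\<Sum>\<^sub>\<infinity>i\<in>D. c (h i) * w i)) UNIV"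
      using has_sum_fibres[OF has_sum_infsum[OF sm], of h] by simp
  qed
  have "(\<Sum>\<^sub>\<infinity>i\<in>A. c (d i) * u i) = (\<Sum>\<^sub>\<infinity>i\<in>B. c (e i) * v i)"
    using *(1)[of u d A, OF u] *(1)[of v e B, OF v] graded_fibre_sums_eq[where F = F, OF u v]
    by (simp add: has_sum_unique)
  then show ?thesis
    using has_sum_infsum[OF *(2)[of u d A, OF u]] by simp
qed

section \<open>Monomials and the multinomial theorem\<close>

lemma vsum_add: "vsum (a + b) = vsum a + vsum b"
  by (simp add: vsum_def sum.distrib)

lemma vsum_scale: "vsum (c *s z) = c * vsum (z :: complex ^ 'k)"
  by (simp add: vsum_def sum_distrib_left)

lemma vpow_add: "vpow z (a + b) = vpow z a * vpow z b"
  by (simp add: vpow_def power_add prod.distrib)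

lemma vpow_sum: "vpow z (\<Sum>r\<in>I. n r) = (\<Prod>r\<in>I. vpow z (n r))"
  by (induction I rule: infinite_finite_induct) (auto simp: vpow_add, auto simp: vpow_def)

lemma vpow_mult: "vpow (w * z) a = vpow w a * vpow z a"
  by (simp add: vpow_def power_mult_distrib prod.distrib)

lemma vpow_scale: "vpow (t *s z) n = t ^ vsum n * vpow z n"
  by (simp add: vpow_def vsum_def power_mult_distrib prod.distrib power_sum)

lemma vpow_uminus: "vpow (- z) n = (- 1) ^ vsum n * vpow z n"
  using vpow_scale[of "-1" z n] by simp

definition vfact :: "nat ^ 'k \<Rightarrow> complex"
  where "vfact n = (\<Prod>i\<in>UNIV. fact (n $ i))"

lemma exp_has_sum: "((\<lambda>n. z ^ n / fact n) has_sum exp (z :: complex)) UNIV"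
proof (rule norm_summable_imp_has_sum)
  show "(\<lambda>n. z ^ n / fact n) sums exp z"
    using exp_converges[of z] by (simp add: scaleR_conv_of_real field_simps)
  show "summable (\<lambda>n. norm (z ^ n / fact n))"
    using summable_norm_exp[of z] by (simp add: norm_divide norm_mult field_simps norm_power)
qed

text \<open>The product of the exponential series of the single components.\<close>

lemma exp_vsum_has_sum: "((\<lambda>n. vpow z n / vfact n) has_sum exp (vsum z)) UNIV"
proof -
  have "((\<lambda>g. \<Prod>i\<in>UNIV. (z $ i) ^ g i / fact (g i)) has_sum (\<Prod>i\<in>UNIV. exp (z $ i)))
          (UNIV \<rightarrow>\<^sub>E UNIV)"
    by (intro has_sum_prod_PiE exp_has_sum) auto
  also have "?this \<longleftrightarrow> ((\<lambda>n. vpow z n / vfact n) has_sum (\<Prod>i\<in>UNIV. exp (z $ i))) UNIV"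
    by (rule has_sum_reindex_bij_witness[where i = vec_nth and j = vec_lambda])
       (auto simp: vpow_def vfact_def prod_dividef)
  finally show ?thesis by (simp add: exp_sum vsum_def)
qed

text \<open>
  Both sides are the coefficient of \<open>t ^ p\<close> in \<open>exp (t * vsum z)\<close>: on the left this function is
  expanded as a product of exponentials, on the right as a single exponential series.
\<close>

lemma multinomial_homogeneous:
  "((\<lambda>n. vpow z n / vfact n) has_sum (vsum z) ^ p / fact p) {n. vsum n = p}"
proof -
  have "(\<Sum>\<^sub>\<infinity>n\<in>{n\<in>UNIV. vsum n = p}. vpow z n / vfact n) = (\<Sum>\<^sub>\<infinity>q\<in>{q\<in>UNIV. id q = p}. vsum z ^ q / fact q)"
  proof (rule graded_fibre_sums_eq)
    show "((\<lambda>n. vpow z n / vfact n * t ^ vsum n) has_sum exp (t * vsum z)) UNIV" for t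
      using exp_vsum_has_sum[of "t *s z"] by (simp add: vpow_scale vsum_scale mult_ac)
    show "((\<lambda>q. vsum z ^ q / fact q * t ^ id q) has_sum exp (t * vsum z)) UNIV" for t
      using exp_has_sum[of "t * vsum z"] by (simp add: power_mult_distrib mult_ac)
  qed
  also have "{q\<in>UNIV. id q = p} = {p}" by auto
  finally have eq: "(\<Sum>\<^sub>\<infinity>n\<in>{n. vsum n = p}. vpow z n / vfact n) = (vsum z) ^ p / fact p" by simp
  have "(\<lambda>n. vpow z n / vfact n) summable_on {n. vsum n = p}"
    using summable_on_subset_banach[OF has_sum_imp_summable[OF exp_vsum_has_sum[of z]]] by blast
  from has_sum_infsum[OF this] show ?thesis unfolding eq .
qed

text \<open>
  The absolute values are kept as complex numbers, so that a summation formula for complex vectors,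
  applied to \<open>vabs z\<close>, yields the convergence of its own majorant.
\<close>

definition vabs :: "complex ^ 'k \<Rightarrow> complex ^ 'k"
  where "vabs z = (\<chi> i. of_real (norm (z $ i)))"

lemma vsum_vabs: "vsum (vabs z) = of_real (\<Sum>i\<in>UNIV. norm (z $ i))"
  by (simp add: vsum_def vabs_def)

lemma vpow_vabs: "vpow (vabs z) n = of_real (norm (vpow z n))"
  by (simp add: vpow_def vabs_def norm_power prod_norm[symmetric])

lemma norm_vfact: "norm (vfact n) = (\<Prod>i\<in>UNIV. fact (n $ i))"
  by (simp add: vfact_def prod_norm[symmetric])

lemma vfact_of_real: "vfact n = of_real (norm (vfact n))"
  unfolding norm_vfact by (simp add: vfact_def)

lemma norm_vsum_le: "norm (vsum z) \<le> (\<Sum>i\<in>UNIV. norm (z $ i))"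
  unfolding vsum_def by (rule norm_sum)

section \<open>Power series in the sum of the variables\<close>

text \<open>
  Expanding each power of \<open>vsum z\<close> by the multinomial theorem turns a power series in \<open>vsum z\<close>
  into one in the components of \<open>z\<close>. The multinomial theorem for \<open>vabs z\<close> computes the sum of the
  norms over each degree, so convergence at \<open>vsum (vabs z)\<close> is what makes the rearrangement
  legitimate.
\<close>

lemma has_sum_homogeneous:
  assumes S: "((\<lambda>p. c p * (vsum z ^ p / fact p)) has_sum S) UNIV"
    and sm: "(\<lambda>p. c p * (vsum (vabs z) ^ p / fact p)) summable_on UNIV"
  shows "((\<lambda>n. c (vsum n) * (vpow z n / vfact n)) has_sum S) UNIV"
proof -
  let ?f = "\<lambda>n. c (vsum n) * (vpow z n / vfact n)"
  have eq: "norm (vpow z n / vfact n) = norm (vpow (vabs z) n / vfact n)"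
       "vpow (vabs z) n / vfact n = of_real (norm (vpow z n / vfact n))" for n
    by (simp_all add: vpow_vabs norm_divide flip: vfact_of_real)
  have "((\<lambda>n. norm (vpow z n / vfact n)) has_sum (\<Sum>i\<in>UNIV. norm (z $ i)) ^ p / fact p) {n. vsum n = p}" for p
  proof -
    have "((\<lambda>n. of_real (norm (vpow z n / vfact n))) has_sum
            (of_real ((\<Sum>i\<in>UNIV. norm (z $ i)) ^ p / fact p) :: complex)) {n. vsum n = p}"
      using multinomial_homogeneous[of "vabs z" p] unfolding eq(2) by (simp add: vsum_vabs)
    then show ?thesis by (simp only: has_sum_of_real_iff)
  qed
  then have fib: "((\<lambda>n. norm (?f n)) has_sum norm (c p) * ((\<Sum>i\<in>UNIV. norm (z $ i)) ^ p / fact p)) {n. vsum n = p}" for p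
    by (subst has_sum_cong[where g = "\<lambda>n. norm (c p) * norm (vpow z n / vfact n)"])
       (simp only: norm_mult mem_Collect_eq, rule has_sum_cmult_right)
  have "(\<lambda>p. norm (c p) * ((\<Sum>i\<in>UNIV. norm (z $ i)) ^ p / fact p)) summable_on UNIV"
    using sm by (subst (asm) summable_on_iff_abs_summable_on_complex)
       (simp add: norm_mult norm_divide norm_power vsum_vabs sum_nonneg del: of_real_sum)
  then have "(\<lambda>(p, n). norm (?f n)) summable_on Sigma UNIV (\<lambda>p. {n. vsum n = p})"
    using fib by (intro summable_on_SigmaI[where g = "\<lambda>p. norm (c p) * ((\<Sum>i\<in>UNIV. norm (z $ i)) ^ p / fact p)"]) auto
  also have "?this \<longleftrightarrow> (\<lambda>n. norm (?f n)) summable_on UNIV"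
    by (rule summable_on_reindex_bij_witness[where j = snd and i = "\<lambda>n. (vsum n, n)"]) auto
  finally have f: "?f summable_on UNIV"
    using summable_on_iff_abs_summable_on_complex by blast
  have "(\<Sum>\<^sub>\<infinity>n\<in>{n. vsum n = p}. ?f n) = c p * (vsum z ^ p / fact p)" for p
  proof -
    have "(\<Sum>\<^sub>\<infinity>n\<in>{n. vsum n = p}. ?f n) = (\<Sum>\<^sub>\<infinity>n\<in>{n. vsum n = p}. c p * (vpow z n / vfact n))"
      by (rule infsum_cong) auto
    then show ?thesis
      using infsumI[OF multinomial_homogeneous[of z p]] by (simp only: infsum_cmult_right')
  qed
  then have "infsum ?f UNIV = S"
    using has_sum_fibres[OF has_sum_infsum[OF f], of vsum] S by (simp add: has_sum_unique)
  then show ?thesis using has_sum_infsum[OF f] by simp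
qed

lemma binomial_series_has_sum:
  fixes z a :: complex
  assumes "norm z < 1"
  shows "((\<lambda>n. pochhammer a n * (z ^ n / fact n)) has_sum (1 - z) powr (- a)) UNIV"
proof (rule norm_summable_imp_has_sum)
  have *: "pochhammer a n * (w ^ n / fact n) = (- a gchoose n) * (- w) ^ n" for n and w :: complex
    by (auto simp: gbinomial_pochhammer power_minus[of w])
  show "(\<lambda>n. pochhammer a n * (z ^ n / fact n)) sums (1 - z) powr (- a)"
    unfolding * using gen_binomial_complex[of "- z" "- a"] assms by simp
  obtain R where R: "norm z < R" "R < 1" using assms dense by blast
  then have "R > 0" using norm_ge_zero[of z] by linarith
  have "summable (\<lambda>n. (- a gchoose n) * (of_real R) ^ n)"
    using gen_binomial_complex[of "of_real R" "- a"] R \<open>R > 0\<close> by (auto dest: sums_summable)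
  from powser_insidea[OF this, of "- z"] show "summable (\<lambda>n. norm (pochhammer a n * (z ^ n / fact n)))"
    unfolding * using R \<open>R > 0\<close> by simp
qed

lemma multi_binomial_series_has_sum:
  assumes "(\<Sum>i\<in>UNIV. norm (z $ i)) < 1"
  shows "((\<lambda>n. pochhammer a (vsum n) * (vpow z n / vfact n)) has_sum (1 - vsum z) powr (- a)) UNIV"
proof (rule has_sum_homogeneous)
  show "((\<lambda>p. pochhammer a p * (vsum z ^ p / fact p)) has_sum (1 - vsum z) powr (- a)) UNIV"
    using norm_vsum_le[of z] assms by (intro binomial_series_has_sum) linarith
  show "(\<lambda>p. pochhammer a p * (vsum (vabs z) ^ p / fact p)) summable_on UNIV"
    by (rule has_sum_imp_summable, rule binomial_series_has_sum)
       (use assms in \<open>simp add: vsum_vabs sum_nonneg del: of_real_sum\<close>)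
qed

section \<open>Uniqueness of power series coefficients\<close>

text \<open>
  Scaling a single component of \<open>z\<close> by \<open>t\<close> with \<open>norm t \<le> 1\<close> stays in the domain and grades the
  series by the exponent of that component. By the uniqueness of one-variable coefficients, the
  part of the series with a prescribed exponent there also vanishes on the whole domain. Doing this
  for one component after the other isolates a single monomial.
\<close>

lemma power_series_coeff_zero:
  fixes d :: "nat ^ 'k \<Rightarrow> complex"
  assumes 0: "\<And>z. (\<Sum>i\<in>UNIV. norm (z $ i)) < 1 \<Longrightarrow> ((\<lambda>m. d m * vpow z m) has_sum 0) UNIV"
  shows "d n = 0"
proof -
  have restricted: "((\<lambda>m. d m * vpow z m) has_sum 0) {m. \<forall>i\<in>I. m $ i = n $ i}"
    if "(\<Sum>i\<in>UNIV. norm (z $ i)) < 1" for I z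
    using finite[of I] that
  proof (induction I arbitrary: z rule: finite_induct)
    case empty
    then show ?case using 0 by simp
  next
    case (insert i I)
    let ?A = "{m. \<forall>i\<in>I. m $ i = n $ i}"
    have "((\<lambda>m. (d m * vpow z m) * t ^ (m $ i)) has_sum 0) ?A" if "norm t \<le> 1" for t
    proof -
      define w where "w = (\<chi> j. if j = i then t * z $ j else z $ j)"
      have "norm (w $ j) \<le> norm (z $ j)" for j
        using that by (simp add: w_def norm_mult mult_left_le_one_le)
      then have "(\<Sum>j\<in>UNIV. norm (w $ j)) < 1"
        by (rule order.strict_trans1[OF sum_mono insert.prems])
      moreover have "vpow w m = vpow z m * t ^ (m $ i)" for m
      proof -
        have "vpow w m = (\<Prod>j\<in>UNIV. (z $ j) ^ (m $ j) * (if j = i then t ^ (m $ j) else 1))"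
          unfolding vpow_def w_def by (rule prod.cong) (auto simp: power_mult_distrib)
        then show ?thesis by (simp add: prod.distrib vpow_def)
      qed
      ultimately show ?thesis using insert.IH[of w] by (simp add: mult.assoc)
    qed
    from graded_fibre_sums_eq[where F = "\<lambda>_. 0", OF this, of "\<lambda>_. 0" "\<lambda>_. 0" "{} :: nat set"]
    have sum0: "(\<Sum>\<^sub>\<infinity>m\<in>{m\<in>?A. m $ i = n $ i}. d m * vpow z m) = 0" by simp
    have "(\<lambda>m. d m * vpow z m) summable_on {m\<in>?A. m $ i = n $ i}"
      using summable_on_subset_banach[OF has_sum_imp_summable[OF 0[OF insert.prems]]] by blast
    from has_sum_infsum[OF this] have "((\<lambda>m. d m * vpow z m) has_sum 0) {m\<in>?A. m $ i = n $ i}"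
      unfolding sum0 .
    also have "{m\<in>?A. m $ i = n $ i} = {m. \<forall>i\<in>insert i I. m $ i = n $ i}" by auto
    finally show ?case .
  qed
  \<comment> \<open>any point of the domain without zero components; the \<open>+ 1\<close> makes the sum of norms less than 1\<close>
  define z :: "complex ^ 'k" where "z = (\<chi> i. 1 / of_nat (CARD('k) + 1))"
  have "(\<Sum>i\<in>UNIV. norm (z $ i)) < 1"
    by (simp add: z_def norm_divide del: of_nat_Suc of_nat_add)
  from restricted[OF this, of UNIV]
  have "((\<lambda>m. d m * vpow z m) has_sum 0) {n}"
    by (simp add: vec_eq_iff[symmetric])
  then have "d n * vpow z n = 0"
    using has_sum_finite[of "{n}" "\<lambda>m. d m * vpow z m"] has_sum_unique by fastforce
  moreover have "z $ i \<noteq> 0" for i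
    by (simp add: z_def del: of_nat_Suc of_nat_add)
  then have "vpow z n \<noteq> 0"
    by (simp add: vpow_def)
  ultimately show ?thesis by simp
qed

section \<open>Closed form of the Laguerre polynomials\<close>

lemma norm_pochhammer_le:
  fixes a :: "'a::real_normed_field"
  assumes "norm a \<le> r"
  shows "norm (pochhammer a n) \<le> pochhammer r n"
  unfolding pochhammer_prod prod_norm[symmetric]
  using assms by (intro prod_mono) (auto intro!: norm_triangle_le)

text \<open>
  Expanding first the exponential and then the remaining power of \<open>1 - vsum z\<close>, the generating
  function of the Laguerre polynomials becomes a series over pairs of exponent vectors. Here \<open>a\<close>
  comes from the exponential and \<open>b\<close> from the power; the pair contributes to the monomial \<open>a + b\<close>.
\<close>

definition laguerre_term :: "complex \<Rightarrow> complex ^ 'k \<Rightarrow> nat ^ 'k \<Rightarrow> nat ^ 'k \<Rightarrow> complex"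
  where "laguerre_term \<alpha> x a b =
    vpow (- x) a / vfact a * (pochhammer (\<alpha> + 1 + of_nat (vsum a)) (vsum b) / vfact b)"

text \<open>
  For fixed \<open>a\<close> the sum over \<open>b\<close> is a binomial series with exponent \<open>- \<alpha> - 1 - vsum a\<close>; the part
  \<open>- vsum a\<close> of the exponent rescales the argument of the exponential series that is left.
\<close>

lemma laguerre_term_inner_sum:
  assumes "(\<Sum>i\<in>UNIV. norm (z $ i)) < 1"
  shows "((\<lambda>b. laguerre_term \<alpha> x a b * vpow z (a + b)) has_sum
    (1 - vsum z) powr (- \<alpha> - 1) * (vpow ((- 1 / (1 - vsum z)) *s (x * z)) a / vfact a)) UNIV"
proof -
  have ne: "1 - vsum z \<noteq> 0"
    using norm_vsum_le[of z] assms by auto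
  have "((\<lambda>b. vpow (- x) a / vfact a * vpow z a * (pochhammer (\<alpha> + 1 + of_nat (vsum a)) (vsum b) * (vpow z b / vfact b)))
     has_sum vpow (- x) a / vfact a * vpow z a * (1 - vsum z) powr (- (\<alpha> + 1 + of_nat (vsum a)))) UNIV"
    by (intro has_sum_cmult_right multi_binomial_series_has_sum assms)
  also have "(\<lambda>b. vpow (- x) a / vfact a * vpow z a * (pochhammer (\<alpha> + 1 + of_nat (vsum a)) (vsum b) * (vpow z b / vfact b)))
     = (\<lambda>b. laguerre_term \<alpha> x a b * vpow z (a + b))"
    by (auto simp: laguerre_term_def vpow_add)
  also have "- (\<alpha> + 1 + of_nat (vsum a)) = (- \<alpha> - 1) + - of_nat (vsum a)" by simp
  also have "(1 - vsum z) powr ((- \<alpha> - 1) + - of_nat (vsum a)) = (1 - vsum z) powr (- \<alpha> - 1) / (1 - vsum z) ^ vsum a"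
    unfolding powr_add powr_minus using ne by (simp add: powr_nat' divide_inverse)
  also have "vpow (- x) a / vfact a * vpow z a * ((1 - vsum z) powr (- \<alpha> - 1) / (1 - vsum z) ^ vsum a) =
      (1 - vsum z) powr (- \<alpha> - 1) * (vpow ((- 1 / (1 - vsum z)) *s (x * z)) a / vfact a)"
    unfolding vpow_scale vpow_mult vpow_uminus power_divide by (simp add: mult_ac)
  finally show ?thesis .
qed

lemma laguerre_term_outer_sum:
  assumes "(\<Sum>i\<in>UNIV. norm (z $ i)) < 1"
  shows "((\<lambda>a. (1 - vsum z) powr (- \<alpha> - 1) * (vpow ((- 1 / (1 - vsum z)) *s (x * z)) a / vfact a)) has_sum
    (1 - vsum z) powr (- \<alpha> - 1) * exp (- (vsum (x * z) / (1 - vsum z)))) UNIV"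
proof -
  have "- (vsum (x * z) / (1 - vsum z)) = vsum ((- 1 / (1 - vsum z)) *s (x * z))"
    unfolding vsum_scale by simp
  then show ?thesis
    by (simp only:) (intro has_sum_cmult_right exp_vsum_has_sum)
qed

text \<open>
  The iterated sum is the generating function by the two preceding lemmas. Absolute convergence of
  the double sum comes from the same two lemmas with nonnegative data: replacing \<open>z\<close> by \<open>vabs z\<close>,
  \<open>x\<close> by \<open>- vabs x\<close> and \<open>\<alpha> + 1\<close> by its norm makes all terms nonnegative and at least as large as
  the norms of the original ones.
\<close>

lemma laguerre_term_has_sum:
  assumes z: "(\<Sum>i\<in>UNIV. norm (z $ i)) < 1"
  shows "((\<lambda>(a, b). laguerre_term \<alpha> x a b * vpow z (a + b)) has_sum
    (1 - vsum z) powr (- \<alpha> - 1) * exp (- (vsum (x * z) / (1 - vsum z)))) UNIV"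
proof -
  let ?\<alpha>' = "of_real (norm (\<alpha> + 1)) - 1 :: complex"
  let ?F = "\<lambda>a b. laguerre_term ?\<alpha>' (- vabs x) a b * vpow (vabs z) (a + b)"
  define G where "G a b = norm (vpow x a) / norm (vfact a) *
     (pochhammer (norm (\<alpha> + 1) + of_nat (vsum a)) (vsum b) / norm (vfact b)) * norm (vpow z (a + b))" for a b
  have FG: "?F a b = of_real (G a b)" for a b
    unfolding laguerre_term_def G_def
    by (subst vfact_of_real[of a], subst vfact_of_real[of b])
       (simp add: vpow_vabs pochhammer_of_real[symmetric])
  have G_nonneg: "G a b \<ge> 0" for a b
    using order_trans[OF norm_ge_zero norm_pochhammer_le[of "norm (\<alpha> + 1) + of_nat (vsum a)" _ "vsum b"]]
    unfolding G_def by (intro mult_nonneg_nonneg divide_nonneg_nonneg norm_ge_zero) auto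
  have z': "(\<Sum>i\<in>UNIV. norm (vabs z $ i)) < 1"
    using z by (simp add: vabs_def)
  define g where "g a = (\<Sum>\<^sub>\<infinity>b. G a b)" for a
  have inner: "(G a has_sum g a) UNIV" for a
  proof -
    have "(\<lambda>b. of_real (G a b) :: complex) summable_on UNIV"
      using laguerre_term_inner_sum[OF z', of ?\<alpha>' "- vabs x" a] unfolding FG
      by (rule has_sum_imp_summable)
    then have "G a summable_on UNIV"
      unfolding summable_on_iff_abs_summable_on_complex by (simp add: G_nonneg)
    then show ?thesis
      unfolding g_def by (rule has_sum_infsum)
  qed
  have "(\<lambda>a. of_real (g a) :: complex) summable_on UNIV"
  proof -
    have "((\<lambda>b. ?F a b) has_sum of_real (g a)) UNIV" for a
      unfolding FG has_sum_of_real_iff by (rule inner)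
    then have eq: "(\<lambda>a. of_real (g a)) = (\<lambda>a. (1 - vsum (vabs z)) powr (- ?\<alpha>' - 1) *
        (vpow ((- 1 / (1 - vsum (vabs z))) *s (- vabs x * vabs z)) a / vfact a))"
      using laguerre_term_inner_sum[OF z'] has_sum_unique by blast
    show ?thesis
      unfolding eq by (rule has_sum_imp_summable[OF laguerre_term_outer_sum[OF z']])
  qed
  moreover have "g a \<ge> 0" for a
    unfolding g_def using G_nonneg by (intro infsum_nonneg)
  ultimately have "g summable_on UNIV"
    unfolding summable_on_iff_abs_summable_on_complex by simp
  then have "(\<lambda>(a, b). G a b) summable_on UNIV \<times> UNIV"
    using inner G_nonneg by (intro summable_on_SigmaI[where g = g]) auto
  then have "(\<lambda>p. norm (case p of (a, b) \<Rightarrow> G a b)) summable_on UNIV \<times> UNIV"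
    using G_nonneg by (simp add: case_prod_unfold)
  then have "(\<lambda>(a, b). laguerre_term \<alpha> x a b * vpow z (a + b)) summable_on UNIV \<times> UNIV"
  proof (rule summable_on_complex_comparison, clarsimp)
    fix a b
    have "norm (laguerre_term \<alpha> x a b * vpow z (a + b)) \<le> G a b"
      unfolding laguerre_term_def G_def norm_mult norm_divide vpow_uminus
      by (intro mult_right_mono mult_mono divide_right_mono norm_pochhammer_le)
         (auto intro!: norm_triangle_le simp: norm_power)
    then show "norm (laguerre_term \<alpha> x a b * vpow z (a + b)) \<le> \<bar>G a b\<bar>" by simp
  qed
  then show ?thesis
    unfolding UNIV_Times_UNIV[symmetric]
    using laguerre_term_inner_sum[OF z] laguerre_term_outer_sum[OF z]
    by (intro has_sum_SigmaI) auto
qed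

text \<open>
  Collecting the pairs with \<open>a + b = n\<close> gives one family of coefficients of the generating function,
  and there is no other by the uniqueness of power series coefficients.
\<close>

lemma laguerre_eq:
  "laguerre \<alpha> n x = (\<Sum>\<^sub>\<infinity>(a, b)\<in>{(a, b). a + b = n}. laguerre_term \<alpha> x a b)"
proof -
  define l where "l n = (\<Sum>\<^sub>\<infinity>(a, b)\<in>{(a, b). a + b = n}. laguerre_term \<alpha> x a b)" for n
  let ?P = "\<lambda>l. \<forall>z. (\<Sum>i\<in>UNIV. norm (z $ i)) < 1 \<longrightarrow>
       ((\<lambda>m. l m * vpow z m) has_sum
          ((1 - vsum z) powr (- \<alpha> - 1) * exp (- (vsum (x * z) / (1 - vsum z))))) UNIV"
  have l: "?P l"
  proof (intro allI impI)
    fix z :: "complex ^ 'a"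
    assume z: "(\<Sum>i\<in>UNIV. norm (z $ i)) < 1"
    have "(\<Sum>\<^sub>\<infinity>p\<in>{p\<in>UNIV. fst p + snd p = m}. case p of (a, b) \<Rightarrow> laguerre_term \<alpha> x a b * vpow z (a + b)) = l m * vpow z m" for m
      unfolding l_def infsum_cmult_left'[symmetric] by (rule infsum_cong_neutral) auto
    then show "((\<lambda>m. l m * vpow z m) has_sum
          ((1 - vsum z) powr (- \<alpha> - 1) * exp (- (vsum (x * z) / (1 - vsum z))))) UNIV"
      using has_sum_fibres[OF laguerre_term_has_sum[OF z, of \<alpha> x], where g = "\<lambda>p. fst p + snd p"] by simp
  qed
  have "l' = l" if l': "?P l'" for l'
  proof
    fix n
    have "((\<lambda>m. (l' m - l m) * vpow z m) has_sum 0) UNIV" if "(\<Sum>i\<in>UNIV. norm (z $ i)) < 1" for z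
      using has_sum_add[OF l'[rule_format, OF that] has_sum_uminusI[OF l[rule_format, OF that]]]
      by (simp add: left_diff_distrib)
    from power_series_coeff_zero[OF this, where n = n] show "l' n = l n" by simp
  qed
  with l have "(THE l. ?P l) = l" by (rule the_equality)
  then show ?thesis by (simp add: laguerre_def l_def)
qed

section \<open>The generating functions of the two kinds of factors\<close>

text \<open>
  The shift of the parameter by \<open>vsum n\<close> is what decouples the two exponent vectors: for
  \<open>n = p + q\<close> the Pochhammer symbol in the closed form starts at \<open>b - vsum q + 1\<close>, which no longer
  involves \<open>p\<close> and is a sign times \<open>pochhammer (- b) (vsum q)\<close>. The double sum therefore factors into
  an exponential and a binomial series. Here \<open>w\<close> is the argument of the Laguerre polynomial with
  the division by \<open>x\<close> undone.
\<close>

lemma twisted_laguerre_has_sum: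
  fixes w x :: "complex ^ 'k"
  assumes x: "\<And>j. x $ j \<noteq> 0" and t: "norm t * (\<Sum>i\<in>UNIV. norm (x $ i)) < 1"
  shows "((\<lambda>n. vpow (- x) n * laguerre (b - of_nat (vsum n)) n (vdiv w x) * t ^ vsum n) has_sum
    exp (t * vsum w) * (1 - t * vsum x) powr b) UNIV"
proof -
  let ?f = "\<lambda>(p, q). vpow (t *s w) p / vfact p * (pochhammer (- b) (vsum q) * (vpow (t *s x) q / vfact q))"
  have "(\<Sum>i\<in>UNIV. norm ((t *s x) $ i)) < 1"
    using t by (simp add: norm_mult sum_distrib_left)
  from has_sum_times[OF exp_vsum_has_sum multi_binomial_series_has_sum[OF this], of "t *s w" "- b"]
  have f: "(?f has_sum exp (t * vsum w) * (1 - t * vsum x) powr b) UNIV"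
    by (simp add: vsum_scale)
  have "laguerre_term (b - of_nat (vsum (p + q))) (vdiv w x) p q * vpow (- x) (p + q) * t ^ vsum (p + q) = ?f (p, q)" for p q
  proof -
    have "x * vdiv w x = w"
      using x by (simp add: vec_eq_iff vdiv_def)
    then have w: "vpow (- vdiv w x) p * vpow (- x) p = vpow w p"
      by (simp add: vpow_mult[symmetric] mult.commute)
    \<comment> \<open>the two occurrences of \<open>vsum p\<close> cancel\<close>
    have "b - of_nat (vsum (p + q)) + 1 + of_nat (vsum p) = b - of_nat (vsum q) + 1"
      by (simp add: vsum_add)
    then have poch: "pochhammer (b - of_nat (vsum (p + q)) + 1 + of_nat (vsum p)) (vsum q)
        = (- 1) ^ vsum q * pochhammer (- b) (vsum q)"
      by (simp only: pochhammer_minus')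
    have "laguerre_term (b - of_nat (vsum (p + q))) (vdiv w x) p q * vpow (- x) (p + q) * t ^ vsum (p + q)
        = (vpow (- vdiv w x) p * vpow (- x) p) * t ^ vsum p / vfact p *
          (((- 1) ^ vsum q * (- 1) ^ vsum q) * pochhammer (- b) (vsum q) * (t ^ vsum q * vpow x q) / vfact q)"
      unfolding laguerre_term_def poch
      unfolding vpow_add vsum_add power_add vpow_uminus[of x q] by simp
    also have "\<dots> = ?f (p, q)"
      unfolding w vpow_scale power_mult_distrib[symmetric] by simp
    finally show ?thesis .
  qed
  then have "(\<Sum>\<^sub>\<infinity>p\<in>{p\<in>UNIV. fst p + snd p = n}. ?f p) =
      (\<Sum>\<^sub>\<infinity>(p, q)\<in>{(p, q). p + q = n}. laguerre_term (b - of_nat (vsum n)) (vdiv w x) p q * (vpow (- x) n * t ^ vsum n))" for n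
    by (intro infsum_cong_neutral) (auto simp: mult_ac)
  also have "\<dots> n = laguerre (b - of_nat (vsum n)) n (vdiv w x) * (vpow (- x) n * t ^ vsum n)" for n
    unfolding laguerre_eq infsum_cmult_left'[symmetric] by (simp add: case_prod_unfold)
  finally show ?thesis
    using has_sum_fibres[OF f, of "\<lambda>p. fst p + snd p"] by (simp add: mult_ac)
qed

lemma humbert_has_sum:
  fixes b X Y t :: complex
  assumes "norm (t * X) < 1"
  shows "((\<lambda>(m, p). pochhammer b m * (X ^ m / fact m) * (Y ^ p / fact p) * t ^ (m + p)) has_sum
    (1 - t * X) powr (- b) * exp (t * Y)) UNIV"
  using has_sum_times[OF binomial_series_has_sum[OF assms, of b] exp_has_sum[of "t * Y"]]
  by (simp add: power_mult_distrib power_add case_prod_unfold mult_ac)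

text \<open>
  The quotients of consecutive terms are \<open>(\<alpha> + j) / (\<gamma> + j)\<close>, which tend to \<open>1\<close> and so are
  eventually smaller than \<open>s\<close>.
\<close>

lemma pochhammer_quotient_bounded:
  fixes \<alpha> \<gamma> :: complex
  assumes "\<gamma> \<notin> \<int>\<^sub>\<le>\<^sub>0" "s > 1"
  obtains C where "\<And>j. norm (pochhammer \<alpha> j / pochhammer \<gamma> j / of_real s ^ j) \<le> C"
proof -
  let ?c = "\<lambda>j. pochhammer \<alpha> j / pochhammer \<gamma> j / of_real s ^ j"
  have "(\<lambda>j. norm ((\<alpha> + of_nat j) / (\<gamma> + of_nat j))) \<longlonglongrightarrow> norm (1::complex)"
  proof (rule tendsto_norm)
    have "(\<lambda>j. (\<alpha> / of_nat j + 1) / (\<gamma> / of_nat j + 1)) \<longlonglongrightarrow> (0 + 1) / (0 + 1)"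
      by (intro tendsto_divide tendsto_add lim_const_over_n tendsto_const) simp
    moreover have "eventually (\<lambda>j. (\<alpha> / of_nat j + 1) / (\<gamma> / of_nat j + 1) = (\<alpha> + of_nat j) / (\<gamma> + of_nat j)) sequentially"
      using eventually_gt_at_top[of 0]
    proof eventually_elim
      case (elim j)
      then have "\<alpha> / of_nat j + 1 = (\<alpha> + of_nat j) / of_nat j" for \<alpha> :: complex
        by (simp add: field_simps)
      then show ?case using elim by simp
    qed
    ultimately show "(\<lambda>j. (\<alpha> + of_nat j) / (\<gamma> + of_nat j)) \<longlonglongrightarrow> 1"
      using Lim_transform_eventually by fastforce
  qed
  then have "eventually (\<lambda>j. norm ((\<alpha> + of_nat j) / (\<gamma> + of_nat j)) < s) sequentially"
    using assms(2) by (intro order_tendstoD) auto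
  then obtain N where N: "\<And>j. j \<ge> N \<Longrightarrow> norm ((\<alpha> + of_nat j) / (\<gamma> + of_nat j)) < s"
    unfolding eventually_sequentially by blast
  have ratio_le: "norm (?c (Suc j)) \<le> norm (?c j)" if "j \<ge> N" for j
  proof -
    have "norm (?c (Suc j)) = norm (?c j) * (norm ((\<alpha> + of_nat j) / (\<gamma> + of_nat j)) / s)"
      using assms(2) by (simp add: pochhammer_Suc norm_mult norm_divide norm_power)
    also have "\<dots> \<le> norm (?c j) * 1"
      using N[OF that] assms(2) by (intro mult_left_mono) (auto simp: divide_le_eq_1)
    finally show ?thesis by simp
  qed
  have "norm (?c j) \<le> (\<Sum>i\<le>N. norm (?c i))" for j
  proof (cases "j \<le> N")
    case True
    then show ?thesis by (intro member_le_sum) auto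
  next
    case False
    then have "N \<le> j" by simp
    then have "norm (?c j) \<le> norm (?c N)"
    proof (induction rule: dec_induct)
      case base
      show ?case by (rule order_refl)
    next
      case (step i)
      then show ?case using order_trans[OF ratio_le[of i]] by blast
    qed
    also have "\<dots> \<le> (\<Sum>i\<le>N. norm (?c i))" by (intro member_le_sum) auto
    finally show ?thesis .
  qed
  then show ?thesis using that by blast
qed

section \<open>The multiple series for Humbert's function\<close>

theorem theorem3p3:
  fixes L :: nat
    and \<beta> :: "nat \<Rightarrow> complex"
    and \<alpha> \<gamma> :: complex
    and \<sigma> :: "nat \<Rightarrow> complex ^ 'k"
    and x y :: "complex ^ 'k"
  assumes "L \<ge> 1"
    and "\<And>r. r \<in> {1..L} \<Longrightarrow> \<beta> r - \<beta> (r - 1) \<notin> \<int>\<^sub>\<le>\<^sub>0"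
    and "\<gamma> \<notin> \<int>\<^sub>\<le>\<^sub>0"
    and "\<And>j. x $ j \<noteq> 0"
    and "(\<Sum>j\<in>UNIV. norm (x $ j)) < 1"
  shows "((\<lambda>n :: nat \<Rightarrow> nat ^ 'k.
            let N = (\<Sum>r\<in>{1..L}. vsum (n r)) in
              pochhammer \<alpha> N / pochhammer \<gamma> N
              * vpow (- x) (\<Sum>r\<in>{1..L}. n r)
              * (\<Prod>r\<in>{1..L}. laguerre (\<beta> r - \<beta> (r - 1) - of_nat (vsum (n r))) (n r)
                   ((1 - \<sigma> r) * (\<Prod>s\<in>{1..<r}. \<sigma> s) * vdiv y x))
              * humbert_Phi1 (\<alpha> + of_nat N) (\<beta> L) (\<gamma> + of_nat N) (vsum x)
                  (vsum ((\<Prod>s\<in>{1..L}. \<sigma> s) * y)))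
          has_sum humbert_Phi1 \<alpha> (\<beta> 0) \<gamma> (vsum x) (vsum y))
          ({1..L} \<rightarrow>\<^sub>E UNIV)"
proof -
  define X where "X = vsum x"
  define Y where "Y = vsum ((\<Prod>s\<in>{1..L}. \<sigma> s) * y)"
  \<comment> \<open>\<open>vdiv (w r) x\<close> is the argument of the \<open>r\<close>-th Laguerre polynomial, \<open>l r\<close> its factor in the series,
    and \<open>h\<close> the part of a term of Humbert's function that is not a quotient of Pochhammer symbols in
    \<open>\<alpha>\<close> and \<open>\<gamma>\<close>.\<close>
  define w where "w r = (1 - \<sigma> r) * (\<Prod>s\<in>{1..<r}. \<sigma> s) * y" for r
  define b where "b r = \<beta> r - \<beta> (r - 1)" for r
  define \<rho> where "\<rho> = (\<Sum>j\<in>UNIV. norm (x $ j))"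
  define l where "l r n = vpow (- x) n * laguerre (b r - of_nat (vsum n)) n (vdiv (w r) x)" for r n
  define h where "h \<beta> Z m p = pochhammer \<beta> m * (X ^ m / fact m) * (Z ^ p / fact p)"
    for \<beta> Z :: complex and m p :: nat
  define N where "N n = (\<Sum>r\<in>{1..L}. vsum (n r))" for n :: "nat \<Rightarrow> nat ^ 'k"
  have "\<rho> \<ge> 0" by (simp add: \<rho>_def sum_nonneg)
  \<comment> \<open>The weights in \<open>\<alpha>\<close> and \<open>\<gamma>\<close> may grow polynomially. Dividing them by \<open>s ^ j\<close> makes them bounded,
    and the factor \<open>s ^ j\<close> can be moved into the terms, since \<open>s * \<rho> < 1\<close> leaves room for it.\<close>
  obtain s where s: "s > 1" "s * \<rho> < 1"
  proof
    show "2 / (1 + \<rho>) > 1" "2 / (1 + \<rho>) * \<rho> < 1"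
      using assms(5) \<open>\<rho> \<ge> 0\<close> by (simp_all add: \<rho>_def[symmetric] field_simps)
  qed
  obtain C where C: "\<And>j. norm (pochhammer \<alpha> j / pochhammer \<gamma> j / of_real s ^ j) \<le> C"
    using pochhammer_quotient_bounded[OF assms(3) s(1)] by blast
  define c where "c j = pochhammer \<alpha> j / pochhammer \<gamma> j / of_real s ^ j" for j
  \<comment> \<open>\<open>u\<close> lists the terms of the multiple series with its last factor expanded, \<open>v\<close> those of the
    single function on the other side, both without the weights; \<open>d\<close> and \<open>m + p\<close> are the degrees.
    Both families turn out to have the generating function \<open>F\<close>.\<close>
  define u where "u = (\<lambda>(n, m, p). (\<Prod>r\<in>{1..L}. l r (n r)) * h (\<beta> L) Y m p * of_real s ^ (N n + (m + p)))"
  define v where "v = (\<lambda>(m, p). h (\<beta> 0) (vsum y) m p * of_real s ^ (m + p))"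
  define d where "d = (\<lambda>(n, m, p). N n + (m + p))"
  define F where "F t = (1 - of_real s * t * X) powr (- \<beta> 0) * exp (of_real s * t * vsum y)" for t
  have small: "norm (of_real s * t) * \<rho> < 1" "norm (of_real s * t * X) < 1" if "norm t \<le> 1" for t :: complex
  proof -
    have "norm (of_real s * t) * \<rho> \<le> s * \<rho>"
      using that s \<open>\<rho> \<ge> 0\<close> by (simp add: norm_mult mult_right_mono)
    then show *: "norm (of_real s * t) * \<rho> < 1" using s by linarith
    have "norm (of_real s * t * X) \<le> norm (of_real s * t) * \<rho>"
      unfolding X_def \<rho>_def norm_mult[of _ "vsum x"] by (intro mult_left_mono norm_vsum_le) auto
    then show "norm (of_real s * t * X) < 1" using * by linarith
  qed
  have v: "((\<lambda>q. v q * t ^ (fst q + snd q)) has_sum F t) UNIV" if "norm t \<le> 1" for t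
    using humbert_has_sum[OF small(2)[OF that], of "\<beta> 0" "vsum y"]
    by (simp add: v_def h_def F_def case_prod_unfold power_mult_distrib mult_ac)
  have beta_telescope: "(\<Sum>r\<in>{1..M}. b r) = \<beta> M - \<beta> 0" for M
    by (induction M) (auto simp: b_def)
  have y_telescope: "(\<Sum>r\<in>{1..M}. vsum (w r)) + vsum ((\<Prod>s\<in>{1..M}. \<sigma> s) * y) = vsum y" for M
  proof (induction M)
    case (Suc M)
    have "w (Suc M) + (\<Prod>s\<in>{1..Suc M}. \<sigma> s) * y = (\<Prod>s\<in>{1..M}. \<sigma> s) * y"
      by (simp add: w_def atLeastLessThanSuc_atLeastAtMost algebra_simps)
    then show ?case
      using Suc by (simp add: vsum_add[symmetric] add.assoc)
  qed simp
  have u: "((\<lambda>i. u i * t ^ d i) has_sum F t) (({1..L} \<rightarrow>\<^sub>E UNIV) \<times> UNIV)" if "norm t \<le> 1" for t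
  proof -
    let ?T = "of_real s * t"
    have ne: "1 - ?T * X \<noteq> 0" using small(2)[OF that] by auto
    have "((\<lambda>n. l r n * ?T ^ vsum n) has_sum exp (?T * vsum (w r)) * (1 - ?T * X) powr b r) UNIV" for r
      unfolding l_def X_def using twisted_laguerre_has_sum[OF assms(4), of ?T "b r" "w r"] small(1)[OF that]
      by (simp add: \<rho>_def)
    then have "((\<lambda>n. \<Prod>r\<in>{1..L}. l r (n r) * ?T ^ vsum (n r)) has_sum
        (\<Prod>r\<in>{1..L}. exp (?T * vsum (w r)) * (1 - ?T * X) powr b r)) ({1..L} \<rightarrow>\<^sub>E UNIV)"
      by (intro has_sum_prod_PiE) auto
    moreover have "((\<lambda>(m, p). h (\<beta> L) Y m p * ?T ^ (m + p)) has_sum (1 - ?T * X) powr (- \<beta> L) * exp (?T * Y)) UNIV"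
      using humbert_has_sum[OF small(2)[OF that]] by (simp add: h_def)
    ultimately have "((\<lambda>(n, q). (\<Prod>r\<in>{1..L}. l r (n r) * ?T ^ vsum (n r)) *
           (case q of (m, p) \<Rightarrow> h (\<beta> L) Y m p * ?T ^ (m + p))) has_sum
        (\<Prod>r\<in>{1..L}. exp (?T * vsum (w r)) * (1 - ?T * X) powr b r) *
        ((1 - ?T * X) powr (- \<beta> L) * exp (?T * Y))) (({1..L} \<rightarrow>\<^sub>E UNIV) \<times> UNIV)"
      by (rule has_sum_times)
    moreover have "(\<lambda>(n, q). (\<Prod>r\<in>{1..L}. l r (n r) * ?T ^ vsum (n r)) *
           (case q of (m, p) \<Rightarrow> h (\<beta> L) Y m p * ?T ^ (m + p))) = (\<lambda>i. u i * t ^ d i)"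
      by (auto simp: u_def d_def N_def prod.distrib power_sum power_add power_mult_distrib mult_ac)
    moreover have "(\<Prod>r\<in>{1..L}. exp (?T * vsum (w r)) * (1 - ?T * X) powr b r) *
        ((1 - ?T * X) powr (- \<beta> L) * exp (?T * Y)) = F t"
    proof -
      have "(\<Prod>r\<in>{1..L}. exp (?T * vsum (w r))) * exp (?T * Y) = exp (?T * ((\<Sum>r\<in>{1..L}. vsum (w r)) + Y))"
        by (simp add: exp_sum exp_add distrib_left sum_distrib_left)
      then have e: "(\<Prod>r\<in>{1..L}. exp (?T * vsum (w r))) * exp (?T * Y) = exp (?T * vsum y)"
        using y_telescope[of L] by (simp add: Y_def)
      have "(\<Prod>r\<in>{1..L}. (1 - ?T * X) powr b r) * (1 - ?T * X) powr (- \<beta> L)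
          = (1 - ?T * X) powr ((\<Sum>r\<in>{1..L}. b r) + - \<beta> L)"
        by (simp only: powr_sum[OF ne] powr_add)
      then have p: "(\<Prod>r\<in>{1..L}. (1 - ?T * X) powr b r) * (1 - ?T * X) powr (- \<beta> L) = (1 - ?T * X) powr (- \<beta> 0)"
        using beta_telescope[of L] by simp
      show ?thesis unfolding F_def e[symmetric] p[symmetric] prod.distrib by (simp add: mult_ac)
    qed
    ultimately show ?thesis by simp
  qed
  have "s \<noteq> 0" using s by simp
  have rhs: "(\<Sum>\<^sub>\<infinity>q. c (fst q + snd q) * v q) = humbert_Phi1 \<alpha> (\<beta> 0) \<gamma> (vsum x) (vsum y)"
    unfolding humbert_Phi1_def using \<open>s \<noteq> 0\<close>
    by (intro infsum_cong) (auto simp: c_def v_def h_def X_def mult_ac)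
  have total: "((\<lambda>i. c (d i) * u i) has_sum humbert_Phi1 \<alpha> (\<beta> 0) \<gamma> (vsum x) (vsum y))
      (({1..L} \<rightarrow>\<^sub>E UNIV) \<times> UNIV)"
    using graded_weighted_sum_eq[where F = F and c = c and C = C, OF u v] C
    unfolding rhs by (simp add: c_def)
  \<comment> \<open>The weight of degree \<open>N n + (m + p)\<close> splits off the weight of degree \<open>N n\<close>; what remains are
    the weights of Humbert's function with both parameters shifted by \<open>N n\<close>.\<close>
  have inner: "(\<Sum>\<^sub>\<infinity>q. c (d (n, q)) * u (n, q)) = pochhammer \<alpha> (N n) / pochhammer \<gamma> (N n)
      * (\<Prod>r\<in>{1..L}. l r (n r)) * humbert_Phi1 (\<alpha> + of_nat (N n)) (\<beta> L) (\<gamma> + of_nat (N n)) X Y" for n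
    unfolding humbert_Phi1_def infsum_cmult_right'[symmetric] using \<open>s \<noteq> 0\<close>
    by (intro infsum_cong)
       (auto simp: c_def d_def u_def h_def pochhammer_product'[of _ "N n"] mult_ac)
  have "((\<lambda>n. pochhammer \<alpha> (N n) / pochhammer \<gamma> (N n) * (\<Prod>r\<in>{1..L}. l r (n r))
      * humbert_Phi1 (\<alpha> + of_nat (N n)) (\<beta> L) (\<gamma> + of_nat (N n)) X Y) has_sum
      humbert_Phi1 \<alpha> (\<beta> 0) \<gamma> (vsum x) (vsum y)) ({1..L} \<rightarrow>\<^sub>E UNIV)"
  proof (rule has_sum_SigmaD[OF total])
    fix n :: "nat \<Rightarrow> nat ^ 'k"
    assume "n \<in> {1..L} \<rightarrow>\<^sub>E UNIV"
    then have "(\<lambda>q. c (d (n, q)) * u (n, q)) summable_on UNIV"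
      using summable_on_SigmaD1[of "\<lambda>n q. c (d (n, q)) * u (n, q)"] has_sum_imp_summable[OF total]
      by (simp add: case_prod_unfold)
    from has_sum_infsum[OF this]
    show "((\<lambda>q. c (d (n, q)) * u (n, q)) has_sum pochhammer \<alpha> (N n) / pochhammer \<gamma> (N n)
      * (\<Prod>r\<in>{1..L}. l r (n r)) * humbert_Phi1 (\<alpha> + of_nat (N n)) (\<beta> L) (\<gamma> + of_nat (N n)) X Y) UNIV"
      unfolding inner .
  qed
  moreover have "vdiv (w r) x = (1 - \<sigma> r) * (\<Prod>s\<in>{1..<r}. \<sigma> s) * vdiv y x" for r
    by (simp add: vec_eq_iff vdiv_def w_def)
  ultimately show ?thesis
    by (simp add: Let_def N_def l_def b_def X_def Y_def vpow_sum prod.distrib mult.assoc)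
qed

end
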